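(* Let $n\ge 1$. The set of words for the left-divisors of $\rho_n^{n+1}$ in $M_n$ is in bijection with the set of Schröder trees with $n+2$ leaves.
   Context: For $n\ge 1$, $M_n$ is the monoid with presentation $\langle \rho_1,\dots,\rho_n \mid \rho_1\rho_n\rho_i=\rho_{i+1}\rho_n \text{ for all } 1\le i\le n-1\rangle$. A left-divisor of $b\in M_n$ is an $a\in M_n$ such that $ac=b$ for some $c\in M_n$. A word for $x\in M_n$ is a finite (possibly empty) sequence of letters in $\{\rho_1,\dots,\rho_n\}$ whose product in $M_n$ is $x$; the set in the statement is the set of all words representing some left-divisor of $\rho_n^{n+1}$. A Schröder tree is a rooted plane tree in which each inner (non-leaf) vertex has at least two children. *)

theory Defs
  imports "HOL-Algebra.Divisibility"
begin

inductive_set presentation_cong :: "'a set \<Rightarrow> ('a list \<times> 'a list) set \<Rightarrow> ('a list \<times> 'a list) set"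
  for A :: "'a set" and R :: "('a list \<times> 'a list) set"
where
  base: "(u, v) \<in> R \<Longrightarrow> u \<in> lists A \<Longrightarrow> v \<in> lists A \<Longrightarrow> (u, v) \<in> presentation_cong A R"
| refl: "u \<in> lists A \<Longrightarrow> (u, u) \<in> presentation_cong A R"
| sym: "(u, v) \<in> presentation_cong A R \<Longrightarrow> (v, u) \<in> presentation_cong A R"
| trans: "(u, v) \<in> presentation_cong A R \<Longrightarrow> (v, w) \<in> presentation_cong A R
    \<Longrightarrow> (u, w) \<in> presentation_cong A R"
| append: "(u, v) \<in> presentation_cong A R \<Longrightarrow> (u', v') \<in> presentation_cong A R
    \<Longrightarrow> (u @ u', v @ v') \<in> presentation_cong A R"

text \<open>The monoid with generators \<open>A\<close> and relations \<open>u = v\<close> for \<open>(u, v) \<in> R\<close>, as the quotient of the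
  free monoid on \<open>A\<close>. The union in the multiplication is over equal classes.\<close>

definition presented_monoid :: "'a set \<Rightarrow> ('a list \<times> 'a list) set \<Rightarrow> 'a list set monoid" where
  "presented_monoid A R =
     \<lparr>carrier = lists A // presentation_cong A R,
      mult = (\<lambda>X Y. \<Union>x\<in>X. \<Union>y\<in>Y. presentation_cong A R `` {x @ y}),
      one = presentation_cong A R `` {[]}\<rparr>"

lemma presentation_cong_lists:
  "(u, v) \<in> presentation_cong A R \<Longrightarrow> u \<in> lists A \<and> v \<in> lists A"
  by (induction rule: presentation_cong.induct) auto

lemma equiv_presentation_cong: "equiv (lists A) (presentation_cong A R)"
proof (rule equivI)
  show "presentation_cong A R \<subseteq> lists A \<times> lists A"
    by (auto dest: presentation_cong_lists)
  show "refl_on (lists A) (presentation_cong A R)"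
    by (rule refl_onI) (rule presentation_cong.refl)
  show "sym (presentation_cong A R)"
    by (rule symI) (rule presentation_cong.sym)
  show "trans (presentation_cong A R)"
    by (rule transI) (rule presentation_cong.trans)
qed

lemma presented_monoid_mult_class:
  assumes "u \<in> lists A" "v \<in> lists A"
  shows "(presentation_cong A R `` {u}) \<otimes>\<^bsub>presented_monoid A R\<^esub> (presentation_cong A R `` {v})
    = presentation_cong A R `` {u @ v}"
proof -
  let ?C = "presentation_cong A R"
  have eq: "?C `` {x @ y} = ?C `` {u @ v}" if "x \<in> ?C `` {u}" "y \<in> ?C `` {v}" for x y
  proof -
    from that have "(u @ v, x @ y) \<in> ?C"
      by (simp add: presentation_cong.append)
    then show ?thesis
      by (rule equiv_class_eq[OF equiv_presentation_cong, symmetric])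
  qed
  have "u \<in> ?C `` {u}" "v \<in> ?C `` {v}"
    using assms by (simp_all add: presentation_cong.refl)
  then have ne: "?C `` {u} \<noteq> {}" "?C `` {v} \<noteq> {}"
    by (metis empty_iff)+
  have "(\<Union>x\<in>?C `` {u}. \<Union>y\<in>?C `` {v}. ?C `` {x @ y})
      = (\<Union>x\<in>?C `` {u}. \<Union>y\<in>?C `` {v}. ?C `` {u @ v})"
    by (rule SUP_cong[OF HOL.refl], rule SUP_cong[OF HOL.refl], rule eq)
  also have "\<dots> = ?C `` {u @ v}"
    using ne by (simp only: UN_constant if_False)
  finally show ?thesis by (simp add: presented_monoid_def)
qed

lemma monoid_presented_monoid: "monoid (presented_monoid A R)"
proof -
  let ?C = "presentation_cong A R"
  have c: "carrier (presented_monoid A R) = (\<lambda>u. ?C `` {u}) ` lists A"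
    by (auto simp: presented_monoid_def quotient_def)
  have o: "\<one>\<^bsub>presented_monoid A R\<^esub> = ?C `` {[]}"
    by (simp add: presented_monoid_def)
  show ?thesis
  proof (rule monoidI, goal_cases)
    case (1 x y)
    then obtain u v where eqs: "x = ?C `` {u}" "y = ?C `` {v}"
      and l: "u \<in> lists A" "v \<in> lists A"
      unfolding c by (elim imageE)
    then have "u @ v \<in> lists A" by simp
    then show ?case
      unfolding eqs presented_monoid_mult_class[OF l] c by (rule imageI)
  next
    case 2
    have "[] \<in> lists A" by simp
    then show ?case unfolding c o by (rule imageI)
  next
    case (3 x y z)
    then obtain u v w where eqs: "x = ?C `` {u}" "y = ?C `` {v}" "z = ?C `` {w}"
      and l: "u \<in> lists A" "v \<in> lists A" "w \<in> lists A"
      unfolding c by (elim imageE)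
    from l have "u @ v \<in> lists A" "v @ w \<in> lists A" by simp_all
    with l show ?case
      unfolding eqs by (simp only: presented_monoid_mult_class append_assoc)
  next
    case (4 x)
    then obtain u where eqs: "x = ?C `` {u}"
      and l: "u \<in> lists A"
      unfolding c by (elim imageE)
    moreover have "[] \<in> lists A" by simp
    ultimately show ?case
      unfolding eqs o by (simp only: presented_monoid_mult_class append_Nil)
  next
    case (5 x)
    then obtain u where eqs: "x = ?C `` {u}"
      and l: "u \<in> lists A"
      unfolding c by (elim imageE)
    moreover have "[] \<in> lists A" by simp
    ultimately show ?case
      unfolding eqs o by (simp only: presented_monoid_mult_class append_Nil2)
  qed
qed

definition M_relations :: "nat \<Rightarrow> (nat list \<times> nat list) set" where
  "M_relations n = {([1, n, i], [Suc i, n]) | i. 1 \<le> i \<and> i \<le> n - 1}"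

text \<open>Letters are represented by their indices: the number \<open>i\<close> stands for \<open>\<rho>\<^sub>i\<close>.\<close>

definition M_monoid :: "nat \<Rightarrow> nat list set monoid" where
  "M_monoid n = presented_monoid {1..n} (M_relations n)"

definition rho :: "nat \<Rightarrow> nat \<Rightarrow> nat list set" where
  "rho n i = presentation_cong {1..n} (M_relations n) `` {[i]}"

definition word_product :: "nat \<Rightarrow> nat list \<Rightarrow> nat list set" where
  "word_product n w = foldr (\<otimes>\<^bsub>M_monoid n\<^esub>) (map (rho n) w) \<one>\<^bsub>M_monoid n\<^esub>"

definition words_for :: "nat \<Rightarrow> nat list set \<Rightarrow> nat list set" where
  "words_for n x = {w \<in> lists {1..n}. word_product n w = x}"

text \<open>\<open>a divides\<^bsub>G\<^esub> b\<close> means \<open>b = a \<otimes>\<^bsub>G\<^esub> c\<close> for some \<open>c\<close> in the carrier, so that in a noncommutative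
  monoid it is left divisibility.\<close>

definition left_divisors :: "nat \<Rightarrow> nat list set \<Rightarrow> nat list set set" where
  "left_divisors n b = {a \<in> carrier (M_monoid n). a divides\<^bsub>M_monoid n\<^esub> b}"

text \<open>Rooted plane trees; a leaf is a vertex whose list of children is empty.\<close>

datatype plane_tree = Node (children: "plane_tree list")

fun leaves :: "plane_tree \<Rightarrow> nat" where
  "leaves (Node ts) = (if ts = [] then 1 else sum_list (map leaves ts))"

fun schroeder :: "plane_tree \<Rightarrow> bool" where
  "schroeder (Node ts) \<longleftrightarrow> (ts \<noteq> [] \<longrightarrow> length ts \<ge> 2) \<and> (\<forall>t\<in>set ts. schroeder t)"

end

theory Submission
  imports Defs
begin

text \<open>Give the vertex \<open>v\<close> of a Schroeder tree \<open>T\<close>, other than the root, the label \<open>l(p) - l(v)\<close> if it is the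
  first child of its parent \<open>p\<close>, and \<open>n + 1 - l(v)\<close> otherwise, where \<open>l\<close> counts the leaves below a vertex.
  Reading the labels in postorder as \<open>T\<close> runs through the trees with \<open>n + 1\<close> leaves gives exactly the words for
  \<open>\<rho>\<^sub>n\<^bsup>n+1\<^esup>\<close>: applying a relation replaces consecutive siblings \<open>v\<close>, leaf by a vertex with these two
  children, or conversely. The words for left divisors are the prefixes of these words. Since the label of
  a first child reveals the number of leaves of its parent, a deterministic stack machine recovers from a
  prefix the vertices that have been entered but not completed, with the completed subtrees below each.
  Reading off these subtrees along the last branch of a tree with \<open>n + 2\<close> leaves puts the
  stacks in bijection with such trees.\<close>

section \<open>Schroeder trees\<close>

abbreviation forest_leaves :: "plane_tree list \<Rightarrow> nat" where
  "forest_leaves F \<equiv> sum_list (map leaves F)"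

lemma leaves_pos: "1 \<le> leaves t"
proof (induction t rule: leaves.induct)
  case (1 ts)
  then show ?case by (cases ts) (auto simp: trans_le_add1)
qed

lemma length_le_forest_leaves: "length F \<le> forest_leaves F"
proof (induction F)
  case (Cons t F)
  then show ?case using leaves_pos[of t] by simp
qed simp

lemma forest_leaves_pos: "F \<noteq> [] \<Longrightarrow> 1 \<le> forest_leaves F"
  using length_le_forest_leaves[of F] by (cases F) auto

lemma leaves_eq_1: "schroeder t \<Longrightarrow> leaves t = 1 \<longleftrightarrow> t = Node []"
  using length_le_forest_leaves[of "children t"] by (cases t) auto

section \<open>Stacks of forests\<close>

text \<open>An entry \<open>(s, F)\<close> is a vertex with \<open>s\<close> leaves whose completed children are \<open>F\<close>; the innermost vertex comes
  first. A vertex enters the stack only once its first child is complete, so there may be unseen vertices between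
  consecutive entries, and its leaves need only fit into the \<open>room\<close> left by the next entry.\<close>

type_synonym tree_stack = "(nat \<times> plane_tree list) list"

fun room :: "nat \<Rightarrow> (nat \<times> nat) list \<Rightarrow> nat" where
  "room r [] = r"
| "room r ((s, c) # st) = s - c"

definition shape :: "tree_stack \<Rightarrow> (nat \<times> nat) list" where
  "shape = map (map_prod id forest_leaves)"

lemma shape_simps [simp]:
  "shape [] = []" "shape ((s, F) # st) = (s, forest_leaves F) # shape st"
  "shape (st @ st') = shape st @ shape st'"
  by (simp_all add: shape_def)

fun valid :: "nat \<Rightarrow> tree_stack \<Rightarrow> bool" where
  "valid r [] \<longleftrightarrow> True"
| "valid r ((s, F) # st) \<longleftrightarrow>
     2 \<le> s \<and> s \<le> room r (shape st) \<and> F \<noteq> [] \<and> (\<forall>t\<in>set F. schroeder t) \<and> forest_leaves F \<le> s \<and>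
     (2 \<le> length F \<or> forest_leaves F < s) \<and> valid r st"

lemma room_le: "valid r st \<Longrightarrow> room r (shape st) \<le> r"
  by (induction st rule: valid.induct) auto

lemma room_shape_append:
  "room r (shape (st @ [(s, F)])) = room (s - forest_leaves F) (shape st)"
  by (cases st) auto

text \<open>\<open>valid\<close> peels off the innermost vertex, while trees are matched with stacks
  from the outermost one; inside that vertex only its \<open>s - forest_leaves F\<close> missing
  leaves are available.\<close>

lemma valid_append:
  "valid r (st @ [(s, F)]) \<longleftrightarrow> valid r [(s, F)] \<and> valid (s - forest_leaves F) st"
proof (induction st)
  case (Cons e st)
  obtain s' F' where "e = (s', F')" by fastforce
  with Cons show ?case by (simp add: room_shape_append del: shape_simps(3)) blast
qed simp

lemma valid_mono: "valid r st \<Longrightarrow> r \<le> r' \<Longrightarrow> valid r' st"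
  by (cases st rule: rev_cases) (auto simp: valid_append)

lemma valid_pred:
  assumes "valid r (st @ [(s, F)])" "s < r"
  shows "valid (r - 1) (st @ [(s, F)])"
  using assms by (auto simp: valid_append)

section \<open>Bijection between trees with \<open>r + 1\<close> leaves and stacks with bound
  \<open>r\<close>\<close>

lemma size_child: "t \<in> set ts \<Longrightarrow> size t < size (Node ts)"
  by (induction ts) auto

text \<open>A tree with \<open>r + 1\<close> leaves yields a stack whose outermost vertex has at most \<open>r\<close> leaves: exactly \<open>r\<close> for a
  general tree, and at most \<open>r - 1\<close> if the root has two children, the second of them a leaf.\<close>

function stack_of_tree :: "plane_tree \<Rightarrow> tree_stack" where
  "stack_of_tree (Node ts) =
     (if ts = [] then []
      else if length ts = 2 \<and> last ts = Node [] then stack_of_tree (hd ts)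
      else stack_of_tree (last ts) @ [(forest_leaves ts - 1, butlast ts)])"
  by pat_completeness auto
termination
proof (relation "measure size", goal_cases)
  case (2 ts)
  then show ?case using size_child[of "hd ts" ts] by simp
next
  case (3 ts)
  then show ?case using size_child[of "last ts" ts] by simp
qed simp

lemma stack_of_tree_snoc:
  assumes "F \<noteq> []"
  shows "stack_of_tree (Node (F @ [X])) =
    (if length F = 1 \<and> X = Node [] then stack_of_tree (hd F)
     else stack_of_tree X @ [(forest_leaves F + leaves X - 1, F)])"
  using assms by simp

declare stack_of_tree.simps [simp del]

lemma stack_of_tree_leaf [simp]: "stack_of_tree (Node []) = []"
  by (simp add: stack_of_tree.simps)

lemma stack_of_tree_graft [simp]: "stack_of_tree (Node [t, Node []]) = stack_of_tree t"
  by (simp add: stack_of_tree.simps)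

lemma schroeder_cases:
  assumes "schroeder t"
  obtains (leaf) "t = Node []"
  | (graft) u where "t = Node [u, Node []]" "schroeder u"
  | (branch) F X where "t = Node (F @ [X])" "F \<noteq> []" "\<not> (length F = 1 \<and> X = Node [])"
      "\<forall>u\<in>set F. schroeder u" "schroeder X"
proof (cases t)
  case (Node ts)
  show ?thesis
  proof (cases ts rule: rev_cases)
    case Nil
    then show ?thesis using Node leaf by simp
  next
    case (snoc F X)
    show ?thesis
    proof (cases "length F = 1 \<and> X = Node []")
      case True
      then obtain u where "F = [u]" by (auto simp: length_Suc_conv)
      then show ?thesis using graft[of u] True snoc Node assms by auto
    next
      case False
      then show ?thesis using branch[of F X] snoc Node assms by (cases F) auto
    qed
  qed
qed

text \<open>A non-leaf \<open>X\<close> has at least two leaves, and next to a leaf \<open>X\<close>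
  the forest \<open>F\<close> has at least two trees; hence the entry pushed for a branch meets the
  size conditions of \<open>valid\<close>.\<close>

lemma branch_leaves:
  assumes "F \<noteq> []" "\<not> (length F = 1 \<and> X = Node [])" "schroeder X"
  shows "forest_leaves F + leaves X - 1 \<ge> 2"
    and "2 \<le> length F \<or> forest_leaves F < forest_leaves F + leaves X - 1"
proof -
  have "1 \<le> length F" using assms(1) by (cases F) auto
  with assms length_le_forest_leaves[of F] leaves_pos[of X] leaves_eq_1[of X]
  show "forest_leaves F + leaves X - 1 \<ge> 2"
    and "2 \<le> length F \<or> forest_leaves F < forest_leaves F + leaves X - 1"
    by (linarith | auto)+
qed

lemma valid_stack_of_tree:
  assumes "schroeder t"
  shows "valid (leaves t - 1) (stack_of_tree t)"
  using assms
proof (induction "leaves t" arbitrary: t rule: less_induct)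
  case less
  from less.prems show ?case
  proof (cases t rule: schroeder_cases)
    case leaf
    then show ?thesis by simp
  next
    case (graft u)
    then show ?thesis using less.hyps[of u] by (auto intro: valid_mono)
  next
    case (branch F X)
    have "leaves X < leaves t"
      using branch forest_leaves_pos[of F] by simp
    then have "valid (leaves X - 1) (stack_of_tree X)"
      using less.hyps branch by blast
    then show ?thesis
      using branch branch_leaves[of F X] leaves_pos[of X]
      by (auto simp: stack_of_tree_snoc valid_append)
  qed
qed

lemma inj_stack_of_tree:
  assumes "schroeder t" "schroeder t'" "leaves t = leaves t'" "stack_of_tree t = stack_of_tree t'"
  shows "t = t'"
  using assms
proof (induction "leaves t" arbitrary: t t' rule: less_induct)
  case less
  \<comment> \<open>The outermost vertex tells the two cases apart: it has exactly
    \<open>leaves u\<close> leaves for the branch, but at most \<open>leaves u - 1\<close> for the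
    graft.\<close>
  have graft_branch: False
    if "schroeder u" "F \<noteq> []" "\<not> (length F = 1 \<and> X = Node [])"
      "leaves (Node [u, Node []]) = leaves (Node (F @ [X]))"
      "stack_of_tree (Node [u, Node []]) = stack_of_tree (Node (F @ [X]))"
      "schroeder X" for u F X
    using that valid_stack_of_tree[of u] leaves_pos[of u]
    by (auto simp: stack_of_tree_snoc valid_append)
  have leaf_eq: "t = t'" if "t = Node [] \<or> t' = Node []"
    using that less.prems leaves_eq_1[of t] leaves_eq_1[of t'] by auto
  from less.prems(1) show ?case
  proof (cases t rule: schroeder_cases)
    case leaf
    then show ?thesis using leaf_eq by simp
  next
    case t: (graft u)
    from less.prems(2) show ?thesis
    proof (cases t' rule: schroeder_cases)
      case leaf
      then show ?thesis using leaf_eq by simp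
    next
      case t': (graft u')
      then show ?thesis using t less.hyps[of u u'] less.prems by simp
    next
      case t': (branch F X)
      then show ?thesis using t less.prems graft_branch[of u F X] by simp
    qed
  next
    case t: (branch F X)
    from less.prems(2) show ?thesis
    proof (cases t' rule: schroeder_cases)
      case leaf
      then show ?thesis using leaf_eq by simp
    next
      case t': (graft u')
      then show ?thesis using t less.prems graft_branch[of u' F X] by simp
    next
      case t': (branch F' X')
      have "leaves X < leaves t" using t forest_leaves_pos[of F] by simp
      then show ?thesis
        using t t' less.hyps[of X X'] less.prems by (simp add: stack_of_tree_snoc split: if_splits)
    qed
  qed
qed

lemma surj_stack_of_tree:
  assumes "valid r st"
  shows "\<exists>t. schroeder t \<and> leaves t = r + 1 \<and> stack_of_tree t = st"
  using assms
proof (induction r arbitrary: st rule: less_induct)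
  case (less r)
  have graft: ?case if "r \<noteq> 0" "valid (r - 1) st"
  proof -
    have "r - 1 < r" using that by simp
    from less.IH[OF this that(2)]
    obtain t where "schroeder t" "leaves t = r - 1 + 1" "stack_of_tree t = st"
      by blast
    then show ?thesis using \<open>r \<noteq> 0\<close> by (intro exI[of _ "Node [t, Node []]"]) simp
  qed
  show ?case
  proof (cases st rule: rev_cases)
    case Nil
    show ?thesis
    proof (cases "r = 0")
      case True
      then show ?thesis using Nil by (intro exI[of _ "Node []"]) simp
    next
      case False
      then show ?thesis using Nil graft by simp
    qed
  next
    case (snoc st' e)
    obtain s F where e: "e = (s, F)" by fastforce
    have v: "valid r (st' @ [(s, F)])" using less.prems snoc e by simp
    then have sF: "2 \<le> s" "s \<le> r" "F \<noteq> []" "\<forall>t\<in>set F. schroeder t" "forest_leaves F \<le> s"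
      "2 \<le> length F \<or> forest_leaves F < s" "valid (s - forest_leaves F) st'"
      by (auto simp: valid_append)
    show ?thesis
    proof (cases "s < r")
      case True
      then show ?thesis using valid_pred[OF v True] graft snoc e by simp
    next
      case False
      \<comment> \<open>Here \<open>s = r\<close>, so the tree must be a branch; the inner stack
        fits into the rest of \<open>s\<close> and encodes its last child.\<close>
      have "s - forest_leaves F < r" using sF False forest_leaves_pos[of F] by simp
      then obtain X where X: "schroeder X" "leaves X = s - forest_leaves F + 1" "stack_of_tree X = st'"
        using less.IH sF by blast
      \<comment> \<open>A leaf \<open>X\<close> means \<open>forest_leaves F = s\<close>, which
        validity allows only if \<open>F\<close> has two trees.\<close>
      have "\<not> (length F = 1 \<and> X = Node [])" using sF X by auto
      then have "stack_of_tree (Node (F @ [X])) = st"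
        using X sF snoc e by (auto simp: stack_of_tree_snoc)
      moreover have "schroeder (Node (F @ [X]))" using sF X by (cases F) auto
      moreover have "leaves (Node (F @ [X])) = r + 1" using sF X False by simp
      ultimately show ?thesis by blast
    qed
  qed
qed

lemma bij_stack_of_tree:
  "bij_betw stack_of_tree {t. schroeder t \<and> leaves t = r + 1} {st. valid r st}"
proof (rule bij_betw_imageI)
  show "inj_on stack_of_tree {t. schroeder t \<and> leaves t = r + 1}"
    by (rule inj_onI) (auto intro: inj_stack_of_tree)
  show "stack_of_tree ` {t. schroeder t \<and> leaves t = r + 1} = {st. valid r st}"
  proof (intro subset_antisym subsetI)
    fix st assume "st \<in> stack_of_tree ` {t. schroeder t \<and> leaves t = r + 1}"
    then obtain t where "schroeder t" "leaves t = r + 1" "st = stack_of_tree t" by blast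
    then show "st \<in> {st. valid r st}" using valid_stack_of_tree[of t] by simp
  next
    fix st assume "st \<in> {st. valid r st}"
    then show "st \<in> stack_of_tree ` {t. schroeder t \<and> leaves t = r + 1}"
      using surj_stack_of_tree[of r st] by blast
  qed
qed

section \<open>Reading words\<close>

fun tree_word :: "nat \<Rightarrow> plane_tree \<Rightarrow> nat list" where
  "tree_word n (Node []) = []"
| "tree_word n (Node (t # ts)) = tree_word n t @ forest_leaves ts #
     concat (map (\<lambda>u. tree_word n u @ [n + 1 - leaves u]) ts)"

fun forest_word :: "nat \<Rightarrow> nat \<Rightarrow> plane_tree list \<Rightarrow> nat list" where
  "forest_word n s [] = []"
| "forest_word n s (t # ts) = tree_word n t @ (s - leaves t) #
     concat (map (\<lambda>u. tree_word n u @ [n + 1 - leaves u]) ts)"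

lemma tree_word_Node: "tree_word n (Node F) = forest_word n (forest_leaves F) F"
  by (cases F) auto

lemma forest_word_snoc:
  "forest_word n s (F @ [t]) =
     forest_word n s F @ tree_word n t @ [if F = [] then s - leaves t else n + 1 - leaves t]"
  by (cases F) auto

text \<open>The parameter \<open>s\<close> of \<open>forest_word\<close> is the number of leaves of the parent, which may exceed that of the
  forest when the parent is not complete.\<close>

fun stack_word :: "nat \<Rightarrow> tree_stack \<Rightarrow> nat list" where
  "stack_word n [] = []"
| "stack_word n ((s, F) # st) = stack_word n st @ forest_word n s F"

text \<open>\<open>attach n t j\<close> reads the label \<open>j\<close> of a completed vertex with subtree \<open>t\<close>. For a nonempty
  valid stack, at most one of the two cases applies, as the second forces \<open>leaves t + j \<le> n\<close>.\<close>

fun attach :: "nat \<Rightarrow> plane_tree \<Rightarrow> nat \<Rightarrow> tree_stack \<Rightarrow> tree_stack option" where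
  "attach n t j [] = (if leaves t + j \<le> n + 1 then Some [(leaves t + j, [t])] else None)"
| "attach n t j ((s, F) # st) =
     (if leaves t + j = n + 1 \<and> forest_leaves F + leaves t \<le> s then Some ((s, F @ [t]) # st)
      else if leaves t + j \<le> s - forest_leaves F then Some ((leaves t + j, [t]) # (s, F) # st)
      else None)"

text \<open>The next label in postorder belongs to the innermost vertex if all its leaves are
  present, and to a new leaf otherwise.\<close>

fun step :: "nat \<Rightarrow> tree_stack \<Rightarrow> nat \<Rightarrow> tree_stack option" where
  "step n [] j = (if j \<in> {1..n} then attach n (Node []) j [] else None)"
| "step n ((s, F) # st) j =
     (if j \<notin> {1..n} then None
      else if forest_leaves F = s then attach n (Node F) j st
      else attach n (Node []) j ((s, F) # st))"

fun run :: "('s \<Rightarrow> nat \<Rightarrow> 's option) \<Rightarrow> 's \<Rightarrow> nat list \<Rightarrow> 's option" where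
  "run f st [] = Some st"
| "run f st (j # w) = Option.bind (f st j) (\<lambda>st'. run f st' w)"

section \<open>Bijection between stacks and accepted words\<close>

lemma run_append: "run f st (u @ v) = Option.bind (run f st u) (\<lambda>st'. run f st' v)"
  by (induction u arbitrary: st) (auto simp: bind_eq_Some_conv split: bind_split)

lemma valid_top:
  assumes "valid (n + 1) ((s, F) # st)"
  shows "2 \<le> s" "s \<le> n + 1" "1 \<le> forest_leaves F" "forest_leaves F \<le> s"
  using assms room_le[of "n + 1" st] forest_leaves_pos[of F] by auto

text \<open>Here \<open>st\<close> no longer contains the vertex labelled \<open>j\<close>, so the
  word of its subtree is appended again together with \<open>j\<close>.\<close>

lemma attach_valid:
  assumes "valid (n + 1) st" "schroeder t" "1 \<le> j" "attach n t j st = Some st'"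
  shows "valid (n + 1) st' \<and> stack_word n st' = stack_word n st @ tree_word n t @ [j]"
proof (cases st)
  case Nil
  then show ?thesis using assms leaves_pos[of t] by (auto split: if_splits)
next
  case (Cons e st1)
  obtain s F where e: "e = (s, F)" by fastforce
  show ?thesis
    using assms leaves_pos[of t] valid_top[of n s F st1] length_le_forest_leaves[of F] Cons e
    by (cases F) (auto simp: forest_word_snoc[of n s "_ # _", simplified] split: if_splits)
qed

lemma step_valid:
  assumes "valid (n + 1) st" "step n st j = Some st'"
  shows "valid (n + 1) st' \<and> stack_word n st' = stack_word n st @ [j]"
proof (cases st)
  case Nil
  then show ?thesis using assms attach_valid[of n st "Node []" j st'] by (auto split: if_splits)
next
  case (Cons e st1)
  obtain s F where e: "e = (s, F)" by fastforce
  show ?thesis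
  proof (cases "forest_leaves F = s")
    case True
    \<comment> \<open>Since \<open>forest_leaves F = s\<close>, validity gives \<open>F\<close> at
      least two trees.\<close>
    have "schroeder (Node F)" using assms(1) Cons e True by auto
    then show ?thesis
      using attach_valid[of n st1 "Node F" j st'] assms Cons e True
      by (auto simp: tree_word_Node split: if_splits)
  next
    case False
    then show ?thesis using attach_valid[of n st "Node []" j st'] assms Cons e
      by (auto split: if_splits)
  qed
qed

lemma run_valid:
  assumes "valid (n + 1) st" "run (step n) st w = Some st'"
  shows "valid (n + 1) st' \<and> stack_word n st' = stack_word n st @ w"
  using assms
proof (induction w arbitrary: st)
  case (Cons j w)
  then obtain st1 where "step n st j = Some st1" "run (step n) st1 w = Some st'"
    by (auto simp: bind_eq_Some_conv)
  then show ?case using Cons.IH[of st1] Cons.prems step_valid[of n st j st1] by simp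
qed simp

text \<open>Undoes the last attachment: a vertex enters the stack with its first child, so removing
  an only child removes the entry.\<close>

lemma attach_last:
  assumes "valid (n + 1) ((s, F @ [t]) # st)"
  defines "B \<equiv> if F = [] then st else (s, F) # st"
  defines "j \<equiv> if F = [] then s - leaves t else n + 1 - leaves t"
  shows "attach n t j B = Some ((s, F @ [t]) # st)"
proof (cases "F = []")
  case True
  \<comment> \<open>Below another vertex \<open>s \<le> n\<close>, so \<open>attach\<close> cannot
    mistake the first child \<open>t\<close> for a later sibling.\<close>
  then show ?thesis
    using assms valid_top[of n "fst (hd st)" "snd (hd st)" "tl st"]
    by (cases st) auto
next
  case False
  then show ?thesis
    using assms valid_top[OF assms(1)] forest_leaves_pos[of F] by auto
qed

lemma exists_step:
  assumes "valid (n + 1) st" "st \<noteq> []"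
  shows "\<exists>st0 j. valid (n + 1) st0 \<and> step n st0 j = Some st"
proof -
  obtain s G st1 where st: "st = (s, G) # st1"
    using assms(2) by (metis list.exhaust surj_pair)
  then obtain F t where G: "G = F @ [t]"
    using assms(1) by (cases G rule: rev_cases) auto
  define B where "B = (if F = [] then st1 else (s, F) # st1)"
  define j where "j = (if F = [] then s - leaves t else n + 1 - leaves t)"
  have att: "attach n t j B = Some st"
    using attach_last[of n s F t st1] assms(1) st G by (simp add: B_def j_def)
  have v: "valid (n + 1) ((s, F @ [t]) # st1)" using assms(1) st G by simp
  have B: "valid (n + 1) B" "leaves t \<le> room (n + 1) (shape B)"
    using v leaves_pos[of t] forest_leaves_pos[of F] by (auto simp: B_def)
  have j: "j \<in> {1..n}"
    using valid_top[OF v] v leaves_pos[of t] forest_leaves_pos[of F] by (auto simp: j_def)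
  have t: "schroeder t" using v by simp
  show ?thesis
  proof (cases "t = Node []")
    case True
    then have "step n B j = Some st"
      using att B j by (cases B) auto
    then show ?thesis using B by blast
  next
    case False
    obtain H where H: "t = Node H" "H \<noteq> []" using False by (cases t) auto
    \<comment> \<open>Just before its label was read, \<open>t\<close> was itself the innermost
      vertex, with all its children complete.\<close>
    have "valid (n + 1) ((leaves t, H) # B)"
      using B t H length_le_forest_leaves[of H] by auto
    moreover have "step n ((leaves t, H) # B) j = Some st"
      using att j H by simp
    ultimately show ?thesis by blast
  qed
qed

text \<open>Every nonempty valid stack has a predecessor whose word is shorter by one
  letter.\<close>

lemma run_stack_word:
  assumes "valid (n + 1) st"
  shows "run (step n) [] (stack_word n st) = Some st"
  using assms
proof (induction "length (stack_word n st)" arbitrary: st rule: less_induct)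
  case less
  show ?case
  proof (cases "st = []")
    case False
    then obtain st0 j where st0: "valid (n + 1) st0" "step n st0 j = Some st"
      using exists_step less.prems by blast
    then have "stack_word n st = stack_word n st0 @ [j]" using step_valid by blast
    then show ?thesis using less.hyps[of st0] st0 by (simp add: run_append)
  qed simp
qed

lemma bij_stack_word:
  "bij_betw (stack_word n) {st. valid (n + 1) st} {w. run (step n) [] w \<noteq> None}"
  by (rule bij_betwI[where g = "\<lambda>w. the (run (step n) [] w)"])
    (use run_valid[of n "[]"] in \<open>auto simp: run_stack_word\<close>)

section \<open>Invariance under the relations\<close>

text \<open>Applying a relation changes the trees on the stack, but not their numbers of leaves, on which alone the
  acceptance of a word depends.\<close>

fun attach_shape :: "nat \<Rightarrow> nat \<Rightarrow> nat \<Rightarrow> (nat \<times> nat) list \<Rightarrow> (nat \<times> nat) list option" where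
  "attach_shape n k j [] = (if k + j \<le> n + 1 then Some [(k + j, k)] else None)"
| "attach_shape n k j ((s, c) # st) =
     (if k + j = n + 1 \<and> c + k \<le> s then Some ((s, c + k) # st)
      else if k + j \<le> s - c then Some ((k + j, k) # (s, c) # st)
      else None)"

fun step_shape :: "nat \<Rightarrow> (nat \<times> nat) list \<Rightarrow> nat \<Rightarrow> (nat \<times> nat) list option" where
  "step_shape n [] j = (if j \<in> {1..n} then attach_shape n 1 j [] else None)"
| "step_shape n ((s, c) # st) j =
     (if j \<notin> {1..n} then None
      else if c = s then attach_shape n s j st
      else attach_shape n 1 j ((s, c) # st))"

text \<open>The conditions of \<open>valid\<close> on numbers of leaves; numbers of children are
  invisible in a shape.\<close>

fun valid_shape :: "nat \<Rightarrow> (nat \<times> nat) list \<Rightarrow> bool" where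
  "valid_shape r [] \<longleftrightarrow> True"
| "valid_shape r ((s, c) # st) \<longleftrightarrow>
     2 \<le> s \<and> s \<le> room r st \<and> 1 \<le> c \<and> c \<le> s \<and> valid_shape r st"

lemma valid_shape_room_le: "valid_shape r st \<Longrightarrow> room r st \<le> r"
  by (induction st rule: valid_shape.induct) auto

lemma attach_shape_attach:
  "attach_shape n (leaves t) j (shape st) = map_option shape (attach n t j st)"
  by (cases st) auto

lemma step_shape_step:
  assumes "valid r st"
  shows "step_shape n (shape st) j = map_option shape (step n st j)"
proof (cases st)
  case Nil
  then show ?thesis using attach_shape_attach[of n "Node []" j "[]"] by simp
next
  case (Cons e st1)
  obtain s F where e: "e = (s, F)" by fastforce
  then have "F \<noteq> []" using assms Cons by auto
  then show ?thesis
    using e Cons attach_shape_attach[of n "Node F" j st1] attach_shape_attach[of n "Node []" j st]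
    by auto
qed

lemma run_step_shape:
  assumes "valid (n + 1) st"
  shows "run (step_shape n) (shape st) w = map_option shape (run (step n) st w)"
  using assms
proof (induction w arbitrary: st)
  case (Cons j w)
  show ?case
  proof (cases "step n st j")
    case None
    then show ?thesis using step_shape_step[OF Cons.prems, of n j] by simp
  next
    case (Some st')
    then show ?thesis
      using step_shape_step[OF Cons.prems, of n j] Cons.IH[of st'] step_valid[OF Cons.prems Some]
      by simp
  qed
qed simp

text \<open>A completed vertex with \<open>k\<close> leaves awaits its label. Reading
  \<open>1, n, i\<close> joins it and a leaf under a new vertex labelled \<open>i\<close>; reading
  \<open>Suc i, n\<close> makes the two siblings. Either way the parent gains \<open>k + 1\<close>
  leaves, and a newly entered parent has \<open>k + i + 1\<close>. Without room both runs
  fail.\<close>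

lemma attach_shape_relation:
  assumes "valid_shape (n + 1) b" "1 \<le> i" "i \<le> n - 1" "1 \<le> k" "k \<le> room (n + 1) b"
  shows "Option.bind (Option.bind (attach_shape n k 1 b) (\<lambda>st. step_shape n st n)) (\<lambda>st. step_shape n st i)
    = Option.bind (attach_shape n k (Suc i) b) (\<lambda>st. step_shape n st n)"
proof (cases b)
  case Nil
  then show ?thesis using assms by auto
next
  case (Cons e b1)
  obtain s c where e: "e = (s, c)" by fastforce
  show ?thesis
    using assms valid_shape_room_le[of "n + 1" b1] Cons e
    by (cases b1) auto
qed

lemma step_shape_relation:
  assumes "valid_shape (n + 1) st" "1 \<le> i" "i \<le> n - 1"
  shows "run (step_shape n) st [1, n, i] = run (step_shape n) st [Suc i, n]"
proof (cases st)
  case Nil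
  then show ?thesis using attach_shape_relation[of n "[]" i 1] assms by auto
next
  case (Cons e b)
  obtain s c where e: "e = (s, c)" by fastforce
  show ?thesis
    using attach_shape_relation[of n b i s] attach_shape_relation[of n st i 1] assms Cons e
    by auto
qed

lemma valid_shape_step:
  assumes "valid_shape (n + 1) st" "step_shape n st j = Some st'"
  shows "valid_shape (n + 1) st'"
proof (cases st)
  case Nil
  then show ?thesis using assms by (auto split: if_splits)
next
  case (Cons e b)
  obtain s c where e: "e = (s, c)" by fastforce
  then show ?thesis using Cons assms by (cases b) (auto split: if_splits)
qed

lemma valid_shape_run:
  "valid_shape (n + 1) st \<Longrightarrow> run (step_shape n) st w = Some st' \<Longrightarrow> valid_shape (n + 1) st'"
proof (induction w arbitrary: st)
  case (Cons j w)
  from Cons.prems obtain st1 where st1: "step_shape n st j = Some st1" "run (step_shape n) st1 w = Some st'"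
    by (auto simp: bind_eq_Some_conv)
  then show ?case using Cons.IH[OF valid_shape_step[OF Cons.prems(1)]] by blast
qed simp

abbreviation M_cong :: "nat \<Rightarrow> (nat list \<times> nat list) set" where
  "M_cong n \<equiv> presentation_cong {1..n} (M_relations n)"

lemma run_cong:
  assumes "(u, v) \<in> M_cong n" "valid_shape (n + 1) st"
  shows "run (step_shape n) st u = run (step_shape n) st v"
  using assms
proof (induction arbitrary: st rule: presentation_cong.induct)
  case (base u v)
  then show ?case using step_shape_relation by (auto simp: M_relations_def simp del: run.simps)
next
  case (append u v u' v')
  \<comment> \<open>The second factors are run from the shape reached by the first, which is again
    valid; hence the arbitrary \<open>st\<close>.\<close>
  then show ?case using valid_shape_run by (auto simp: run_append split: bind_split)
qed auto

section \<open>Normal forms of divisors\<close>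

lemma cong_context:
  assumes "(u, v) \<in> M_cong n" "x \<in> lists {1..n}" "y \<in> lists {1..n}"
  shows "(x @ u @ y, x @ v @ y) \<in> M_cong n"
  using assms by (intro presentation_cong.append presentation_cong.refl)

text \<open>Induction on \<open>m\<close>: expanding \<open>[Suc m, n]\<close> to
  \<open>[1, n, m]\<close> exposes the previous case, whose result \<open>[1, n, j + m]\<close>
  contracts to \<open>[Suc (j + m), n]\<close>.\<close>

lemma cong_absorb:
  assumes "1 \<le> m" "1 \<le> j" "j + m \<le> n"
  shows "(m # replicate m n @ [j], (j + m) # replicate m n) \<in> M_cong n"
  using assms
proof (induction m rule: nat_induct_at_least)
  case base
  then show ?case
    by (intro presentation_cong.base) (auto simp: M_relations_def)
next
  case (Suc m)
  have 1: "([1, n, m], [Suc m, n]) \<in> M_cong n"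
    using Suc by (intro presentation_cong.base) (auto simp: M_relations_def)
  have 2: "([1, n, j + m], [Suc (j + m), n]) \<in> M_cong n"
    using Suc by (intro presentation_cong.base) (auto simp: M_relations_def)
  have "([1, n, m] @ replicate m n @ [j], [Suc m, n] @ replicate m n @ [j]) \<in> M_cong n"
    using cong_context[OF 1, of "[]" "replicate m n @ [j]"] Suc by (auto simp: in_lists_conv_set)
  moreover have "([1, n] @ m # replicate m n @ [j], [1, n] @ (j + m) # replicate m n) \<in> M_cong n"
    using cong_context[of "m # replicate m n @ [j]" "(j + m) # replicate m n" n "[1, n]" "[]"] Suc
    by auto
  moreover have "([1, n, j + m] @ replicate m n, [Suc (j + m), n] @ replicate m n) \<in> M_cong n"
    using cong_context[OF 2, of "[]" "replicate m n"] Suc by (auto simp: in_lists_conv_set)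
  ultimately show ?case
    by (auto intro: presentation_cong.sym presentation_cong.trans)
qed

text \<open>The stack word when all completed children are leaves: the first is labelled
  \<open>s - 1\<close>, the others \<open>n\<close>.\<close>

fun shape_word :: "nat \<Rightarrow> (nat \<times> nat) list \<Rightarrow> nat list" where
  "shape_word n [] = []"
| "shape_word n ((s, c) # st) = shape_word n st @ (s - 1) # replicate (c - 1) n"

lemma shape_word_lists:
  "valid_shape (n + 1) st \<Longrightarrow> shape_word n st \<in> lists {1..n}"
proof (induction st)
  case (Cons e st)
  obtain s c where "e = (s, c)" by fastforce
  then show ?case using Cons valid_shape_room_le[of "n + 1" st] by (auto simp: in_lists_conv_set)
qed simp

text \<open>For the shape, a child with \<open>k\<close> leaves and label \<open>j\<close> amounts
  to \<open>k\<close> leaf children, the first labelled \<open>j + k - 1\<close> and the others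
  \<open>n\<close>.\<close>

lemma attach_shape_word:
  assumes "valid_shape (n + 1) st" "1 \<le> k" "1 \<le> j" "attach_shape n k j st = Some st'"
  shows "shape_word n st' = shape_word n st @ (j + k - 1) # replicate (k - 1) n"
proof (cases st)
  case Nil
  then show ?thesis using assms by (auto split: if_splits)
next
  case (Cons e b)
  obtain s c where e: "e = (s, c)" by fastforce
  have "replicate (c + k - 1) n = replicate (c - 1) n @ n # replicate (k - 1) n" if "1 \<le> c"
    using that assms(2) replicate_add[of "c - 1" k n] by (cases k) simp_all
  then show ?thesis
    using Cons e assms by (auto simp: add.commute split: if_splits)
qed

lemma step_shape_word:
  assumes "valid_shape (n + 1) st" "step_shape n st j = Some st'"
  shows "(shape_word n st @ [j], shape_word n st') \<in> M_cong n"
proof (cases st)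
  case Nil
  then show ?thesis
    using assms attach_shape_word[of n "[]" 1 j st']
    by (auto intro!: presentation_cong.refl split: if_splits)
next
  case (Cons e b)
  obtain s c where e: "e = (s, c)" by fastforce
  show ?thesis
  proof (cases "c = s")
    case True
    have j: "1 \<le> j" "j \<le> n" and att: "attach_shape n s j b = Some st'"
      using assms Cons e True by (auto split: if_splits)
    have b: "valid_shape (n + 1) b" "2 \<le> s" "s \<le> room (n + 1) b" using assms Cons e by auto
    \<comment> \<open>Either case of \<open>attach_shape\<close> forces
      \<open>s + j \<le> n + 1\<close>, so \<open>cong_absorb\<close> applies with
      \<open>m = s - 1\<close>: it dissolves the completed vertex into leaves.\<close>
    then have "j + (s - 1) \<le> n"
      using att valid_shape_room_le[of "n + 1" b] by (cases b) (auto split: if_splits)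
    then have "((s - 1) # replicate (s - 1) n @ [j], (j + (s - 1)) # replicate (s - 1) n) \<in> M_cong n"
      using b j by (intro cong_absorb) auto
    from cong_context[OF this shape_word_lists[OF b(1)], of "[]"] show ?thesis
      using attach_shape_word[OF b(1) _ j(1) att] b Cons e True by simp
  next
    case False
    then have "shape_word n st' = shape_word n st @ [j]" "j \<in> {1..n}"
      using assms attach_shape_word[of n st 1 j st'] Cons e by (auto split: if_splits)
    then show ?thesis
      using shape_word_lists[OF assms(1)] by (auto intro!: presentation_cong.refl)
  qed
qed

lemma run_shape_word:
  assumes "valid_shape (n + 1) st" "w \<in> lists {1..n}" "run (step_shape n) st w = Some st'"
  shows "(shape_word n st @ w, shape_word n st') \<in> M_cong n"
  using assms
proof (induction w arbitrary: st)
  case Nil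
  then show ?case using shape_word_lists by (auto intro: presentation_cong.refl)
next
  case (Cons j w)
  then obtain st1 where st1: "step_shape n st j = Some st1" "run (step_shape n) st1 w = Some st'"
    by (auto simp: bind_eq_Some_conv)
  have "valid_shape (n + 1) st1" using Cons.prems st1 valid_shape_step by blast
  then have "(shape_word n st1 @ w, shape_word n st') \<in> M_cong n"
    using Cons st1 by auto
  moreover have "(shape_word n st @ [j] @ w, shape_word n st1 @ w) \<in> M_cong n"
    using cong_context[OF step_shape_word[OF Cons.prems(1) st1(1)], of "[]" w] Cons.prems by simp
  ultimately show ?case by (auto intro: presentation_cong.trans)
qed

text \<open>Vertices are closed from the inside out: fill the innermost one with leaves, then read
  \<open>n + 1 - s\<close>. By \<open>cong_absorb\<close> its word becomes
  \<open>replicate s n\<close>, which is the suffix \<open>replicate q n\<close> of the claim for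
  the remaining stack.\<close>

lemma shape_word_divides:
  assumes "valid_shape (n + 1) st" "q \<le> room (n + 1) st" "1 \<le> n"
  shows "\<exists>v \<in> lists {1..n}. (shape_word n st @ replicate q n @ v, replicate (n + 1) n) \<in> M_cong n"
  using assms(1,2)
proof (induction st arbitrary: q)
  case Nil
  have "replicate q n @ replicate (n + 1 - q) n = replicate (n + 1) n"
    using Nil by (simp only: replicate_add[symmetric]) simp
  then show ?case
    using assms(3)
    by (intro bexI[of _ "replicate (n + 1 - q) n"]) (auto intro!: presentation_cong.refl simp: in_lists_conv_set)
next
  case (Cons e st)
  obtain s c where e: "e = (s, c)" by fastforce
  have st: "valid_shape (n + 1) st" "2 \<le> s" "s \<le> room (n + 1) st" "1 \<le> c" "c \<le> s" "q \<le> s - c"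
    using Cons.prems e by auto
  have "replicate (s - 1) n = replicate (c - 1 + q + (s - c - q)) n"
    using st by simp
  then have fill: "shape_word n (e # st) @ replicate q n @ replicate (s - c - q) n
      = shape_word n st @ (s - 1) # replicate (s - 1) n"
    unfolding replicate_add e by simp
  show ?case
  proof (cases "s = n + 1")
    case True
    \<comment> \<open>A vertex inside another has at most \<open>n\<close> leaves, so this one is
      outermost.\<close>
    then have "st = []"
      using st valid_shape_room_le[of "n + 1" "tl st"] by (cases st) auto
    then have "shape_word n (e # st) @ replicate q n @ replicate (s - c - q) n = replicate (n + 1) n"
      using fill True by simp
    then show ?thesis
      using assms(3)
      by (intro bexI[of _ "replicate (s - c - q) n"]) (auto intro!: presentation_cong.refl simp: in_lists_conv_set)
  next
    case False
    then have s: "s \<le> n" using st valid_shape_room_le[of "n + 1" st] by simp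
    obtain v where v: "v \<in> lists {1..n}"
      "(shape_word n st @ replicate s n @ v, replicate (n + 1) n) \<in> M_cong n"
      using Cons.IH[OF st(1,3)] by blast
    have "((s - 1) # replicate (s - 1) n @ [n + 1 - s], (n + 1 - s + (s - 1)) # replicate (s - 1) n) \<in> M_cong n"
      using st s by (intro cong_absorb) auto
    moreover have "(n + 1 - s + (s - 1)) # replicate (s - 1) n = replicate s n"
      using st s by (cases s) auto
    ultimately have "((s - 1) # replicate (s - 1) n @ [n + 1 - s], replicate s n) \<in> M_cong n"
      by simp
    from cong_context[OF this shape_word_lists[OF st(1)] v(1)] fill
    have "(shape_word n (e # st) @ replicate q n @ (replicate (s - c - q) n @ [n + 1 - s] @ v),
        shape_word n st @ replicate s n @ v) \<in> M_cong n"
      by (metis append.assoc append_Cons)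
    moreover have "replicate (s - c - q) n @ [n + 1 - s] @ v \<in> lists {1..n}"
      using v s st by (auto simp: in_lists_conv_set)
    ultimately show ?thesis using v(2) presentation_cong.trans by blast
  qed
qed

section \<open>Words for left divisors\<close>

lemma carrier_M_monoid: "carrier (M_monoid n) = (\<lambda>u. M_cong n `` {u}) ` lists {1..n}"
  by (auto simp: M_monoid_def presented_monoid_def quotient_def)

lemma one_M_monoid: "\<one>\<^bsub>M_monoid n\<^esub> = M_cong n `` {[]}"
  by (simp add: M_monoid_def presented_monoid_def)

lemma mult_M_monoid:
  "u \<in> lists {1..n} \<Longrightarrow> v \<in> lists {1..n} \<Longrightarrow>
    M_cong n `` {u} \<otimes>\<^bsub>M_monoid n\<^esub> M_cong n `` {v} = M_cong n `` {u @ v}"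
  unfolding M_monoid_def by (rule presented_monoid_mult_class)

lemma class_eq_iff:
  "u \<in> lists {1..n} \<Longrightarrow> v \<in> lists {1..n} \<Longrightarrow>
    M_cong n `` {u} = M_cong n `` {v} \<longleftrightarrow> (u, v) \<in> M_cong n"
  by (rule eq_equiv_class_iff[OF equiv_presentation_cong])

lemma word_product_class: "w \<in> lists {1..n} \<Longrightarrow> word_product n w = M_cong n `` {w}"
proof (induction w)
  case (Cons j w)
  then show ?case
    using mult_M_monoid[of "[j]" n w] by (simp add: word_product_def rho_def)
qed (simp add: word_product_def one_M_monoid)

lemma rho_pow:
  assumes "i \<in> {1..n}"
  shows "rho n i [^]\<^bsub>M_monoid n\<^esub> k = M_cong n `` {replicate k i}"
proof (induction k)
  case 0
  then show ?case by (simp add: one_M_monoid)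
next
  case (Suc k)
  have "replicate k i \<in> lists {1..n}" using assms by (auto simp: in_lists_conv_set)
  with Suc assms show ?case
    using mult_M_monoid[of "replicate k i" n "[i]"] by (simp add: rho_def replicate_append_same)
qed

lemma words_for_left_divisors:
  assumes "b \<in> lists {1..n}"
  shows "(\<Union>x \<in> left_divisors n (M_cong n `` {b}). words_for n x)
    = {w \<in> lists {1..n}. \<exists>v \<in> lists {1..n}. (w @ v, b) \<in> M_cong n}" (is "?L = ?R")
proof -
  have div: "M_cong n `` {w} divides\<^bsub>M_monoid n\<^esub> M_cong n `` {b}
      \<longleftrightarrow> (\<exists>v \<in> lists {1..n}. (w @ v, b) \<in> M_cong n)" if "w \<in> lists {1..n}" for w
  proof -
    have "M_cong n `` {b} = M_cong n `` {w} \<otimes>\<^bsub>M_monoid n\<^esub> M_cong n `` {v} \<longleftrightarrow> (w @ v, b) \<in> M_cong n"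
      if "v \<in> lists {1..n}" for v
    proof -
      have "w @ v \<in> lists {1..n}" using \<open>w \<in> lists {1..n}\<close> that by simp
      then show ?thesis
        unfolding mult_M_monoid[OF \<open>w \<in> lists {1..n}\<close> that] using class_eq_iff[OF _ assms] by blast
    qed
    then show ?thesis unfolding factor_def carrier_M_monoid by blast
  qed
  have words: "w \<in> ?L \<longleftrightarrow> w \<in> lists {1..n} \<and> M_cong n `` {w} divides\<^bsub>M_monoid n\<^esub> M_cong n `` {b}" for w
  proof -
    have "w \<in> ?L \<longleftrightarrow> w \<in> lists {1..n} \<and> word_product n w \<in> left_divisors n (M_cong n `` {b})"
      unfolding words_for_def by blast
    also have "\<dots> \<longleftrightarrow> w \<in> lists {1..n} \<and> M_cong n `` {w} divides\<^bsub>M_monoid n\<^esub> M_cong n `` {b}"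
    proof (rule conj_cong[OF HOL.refl])
      assume w: "w \<in> lists {1..n}"
      then show "word_product n w \<in> left_divisors n (M_cong n `` {b})
          \<longleftrightarrow> M_cong n `` {w} divides\<^bsub>M_monoid n\<^esub> M_cong n `` {b}"
        unfolding word_product_class[OF w] left_divisors_def carrier_M_monoid by blast
    qed
    finally show ?thesis .
  qed
  show ?thesis
  proof (rule Set.set_eqI)
    show "w \<in> ?L \<longleftrightarrow> w \<in> ?R" for w
      unfolding words mem_Collect_eq by (rule conj_cong[OF HOL.refl div])
  qed
qed

lemma run_lists: "run (step_shape n) st w = Some st' \<Longrightarrow> w \<in> lists {1..n}"
proof (induction w arbitrary: st)
  case (Cons j w)
  then obtain st1 where st1: "step_shape n st j = Some st1" "run (step_shape n) st1 w = Some st'"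
    by (auto simp: bind_eq_Some_conv)
  then have "j \<in> {1..n}" by (cases st) (auto split: if_splits)
  then show ?case using Cons.IH st1 by simp
qed simp

lemma run_replicate:
  assumes "1 \<le> n"
  shows "run (step_shape n) [] (replicate (n + 1) n) \<noteq> None"
proof -
  \<comment> \<open>The first letter opens a vertex with \<open>n + 1\<close> leaves; each later one
    adds a leaf child.\<close>
  have *: "1 \<le> c \<Longrightarrow> c + k = n + 1 \<Longrightarrow> run (step_shape n) [(n + 1, c)] (replicate k n) \<noteq> None" for c k
    using assms by (induction k arbitrary: c) auto
  show ?thesis using *[of 1 n] assms by simp
qed

text \<open>Acceptance is invariant under the congruence and passes to prefixes. Conversely, an
  accepted word is congruent to the normal form of its final shape, which divides the power.\<close>

lemma left_divisor_words_eq: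
  assumes "1 \<le> n"
  shows "(\<Union>x \<in> left_divisors n (rho n n [^]\<^bsub>M_monoid n\<^esub> (n + 1)). words_for n x)
    = {w. run (step n) [] w \<noteq> None}"
proof -
  have b: "replicate (n + 1) n \<in> lists {1..n}" using assms by (auto simp: in_lists_conv_set)
  have "w \<in> lists {1..n} \<and> (\<exists>v \<in> lists {1..n}. (w @ v, replicate (n + 1) n) \<in> M_cong n)
      \<longleftrightarrow> run (step_shape n) [] w \<noteq> None" (is "?div \<longleftrightarrow> ?acc") for w
  proof
    assume ?div
    then obtain v where "(w @ v, replicate (n + 1) n) \<in> M_cong n" by blast
    then have "run (step_shape n) [] (w @ v) \<noteq> None"
      using run_cong[of _ _ n "[]"] run_replicate[OF assms] by simp
    then show ?acc by (cases "run (step_shape n) [] w") (simp_all add: run_append)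
  next
    assume ?acc
    then obtain st where st: "run (step_shape n) [] w = Some st" by blast
    then have w: "w \<in> lists {1..n}" by (rule run_lists)
    have cong: "(w, shape_word n st) \<in> M_cong n"
      using run_shape_word[of n "[]" w st] w st by simp
    have "valid_shape (n + 1) st" using valid_shape_run[of n "[]"] st by simp
    then obtain v where v: "v \<in> lists {1..n}" "(shape_word n st @ v, replicate (n + 1) n) \<in> M_cong n"
      using shape_word_divides[of n st 0] assms by auto
    have "(w @ v, shape_word n st @ v) \<in> M_cong n"
      using cong_context[OF cong, of "[]" v] v by simp
    then show ?div using w v presentation_cong.trans by blast
  qed
  moreover have "run (step_shape n) [] w \<noteq> None \<longleftrightarrow> run (step n) [] w \<noteq> None" for w
    using run_step_shape[of n "[]" w] by simp
  ultimately have "{w \<in> lists {1..n}. \<exists>v \<in> lists {1..n}. (w @ v, replicate (n + 1) n) \<in> M_cong n}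
      = {w. run (step n) [] w \<noteq> None}"
    by presburger
  moreover have "rho n n [^]\<^bsub>M_monoid n\<^esub> (n + 1) = M_cong n `` {replicate (n + 1) n}"
    using assms by (intro rho_pow) simp
  ultimately show ?thesis
    using words_for_left_divisors[OF b] by (simp only:)
qed

theorem theorem4p7:
  fixes n :: nat
  assumes "n \<ge> 1"
  shows "\<exists>f. bij_betw f
    (\<Union>x \<in> left_divisors n (rho n n [^]\<^bsub>M_monoid n\<^esub> (n + 1)). words_for n x)
    {t. schroeder t \<and> leaves t = n + 2}"
proof -
  \<comment> \<open>The machine bounds stacks by \<open>r = n + 1\<close>, which corresponds to
    trees with \<open>r + 1 = n + 2\<close> leaves.\<close>
  have "bij_betw (stack_word n \<circ> stack_of_tree) {t. schroeder t \<and> leaves t = n + 1 + 1}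
      {w. run (step n) [] w \<noteq> None}"
    by (rule bij_betw_trans[OF bij_stack_of_tree bij_stack_word])
  then have "bij_betw (stack_word n \<circ> stack_of_tree) {t. schroeder t \<and> leaves t = n + 2}
      (\<Union>x \<in> left_divisors n (rho n n [^]\<^bsub>M_monoid n\<^esub> (n + 1)). words_for n x)"
    unfolding left_divisor_words_eq[OF assms] by simp
  then show ?thesis using bij_betw_inv by blast
qed

end
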